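(* Let $p\in\mathbb{N}$ and let $\mathcal{H}$ be a finite hypergraph of rank $r$. Then the simplicial complex $$\mathrm{Cov}_{\mathcal{H},p}=\{\mathcal{F}\subset\mathcal{H}:\ \tau(\mathcal{F})\le p\}$$ is $\left(\binom{r+p}{r}-1\right)$-collapsible.
   Context: A hypergraph $\mathcal{H}$ is identified with its edge set (a collection of finite sets, the edges); subsets $\mathcal{F}\subset\mathcal{H}$ are again hypergraphs. The rank of $\mathcal{H}$ is the maximal size of an edge of $\mathcal{H}$. A set $C$ is a cover of $\mathcal{F}$ if $A\cap C\neq\emptyset$ for all $A\in\mathcal{F}$. The covering number $\tau(\mathcal{F})$ is the minimal size of a cover of $\mathcal{F}$; so $\tau(\mathcal{F})\le p$ means that $\mathcal{F}$ can be covered by a set of size at most $p$. The vertices of $\mathrm{Cov}_{\mathcal{H},p}$ are edges of $\mathcal{H}$ and its simplices are the sub-hypergraphs $\mathcal{F}$ with $\tau(\mathcal{F})\le p$. Simplicial complexes are finite abstract simplicial complexes (families of finite sets closed under taking subsets); a non-void complex contains the empty simplex, and the void complex $\emptyset$ has no simplices at all (so it differs from $\{\emptyset\}$). Let $X$ be a finite simplicial complex, and let $\eta\in X$ be a simplex (possibly empty) such that $|\eta|\le d$ and $\eta$ is contained in a unique maximal face $\tau$ of $X$. The complex $X'=X\setminus\{\sigma\in X:\ \eta\subset\sigma\subset\tau\}$ is said to be obtained from $X$ by an elementary $d$-collapse. $X$ is $d$-collapsible if there is a finite sequence of elementary $d$-collapses from $X$ to the void complex. *)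

theory Defs
  imports Complex_Main "HOL-Library.Extended_Nat"
begin

definition finite_hypergraph :: "'a set set \<Rightarrow> bool" where
  "finite_hypergraph H \<longleftrightarrow> finite H \<and> (\<forall>A\<in>H. finite A)"

(* The edgeless hypergraph gets rank 0; for H \<noteq> {} this is the maximal edge size. *)
definition hypergraph_rank :: "'a set set \<Rightarrow> nat" where
  "hypergraph_rank H = Max (insert 0 (card ` H))"

definition is_cover :: "'a set \<Rightarrow> 'a set set \<Rightarrow> bool" where
  "is_cover C F \<longleftrightarrow> (\<forall>A\<in>F. A \<inter> C \<noteq> {})"

(* Values in enat: a family containing the empty edge has no cover, and the
   infimum over the empty set is \<infinity>. *)
definition covering_number :: "'a set set \<Rightarrow> enat" where
  "covering_number F = (INF C\<in>{C. finite C \<and> is_cover C F}. enat (card C))"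

definition Cov :: "'a set set \<Rightarrow> nat \<Rightarrow> 'a set set set" where
  "Cov H p = {F. F \<subseteq> H \<and> covering_number F \<le> enat p}"

(* The empty family (the void complex) is allowed and differs from {{}}. *)
definition finite_simplicial_complex :: "'v set set \<Rightarrow> bool" where
  "finite_simplicial_complex X \<longleftrightarrow>
     finite X \<and> (\<forall>\<sigma>\<in>X. finite \<sigma>) \<and> (\<forall>\<sigma>\<in>X. \<forall>\<rho>. \<rho> \<subseteq> \<sigma> \<longrightarrow> \<rho> \<in> X)"

definition maximal_face :: "'v set set \<Rightarrow> 'v set \<Rightarrow> bool" where
  "maximal_face X \<tau> \<longleftrightarrow> \<tau> \<in> X \<and> (\<forall>\<sigma>\<in>X. \<tau> \<subseteq> \<sigma> \<longrightarrow> \<sigma> = \<tau>)"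

definition elementary_collapse :: "nat \<Rightarrow> 'v set set \<Rightarrow> 'v set set \<Rightarrow> bool" where
  "elementary_collapse d X X' \<longleftrightarrow>
     (\<exists>\<eta> \<tau>. \<eta> \<in> X \<and> card \<eta> \<le> d \<and>
        maximal_face X \<tau> \<and> \<eta> \<subseteq> \<tau> \<and>
        (\<forall>\<tau>'. maximal_face X \<tau>' \<and> \<eta> \<subseteq> \<tau>' \<longrightarrow> \<tau>' = \<tau>) \<and>
        X' = X - {\<sigma>\<in>X. \<eta> \<subseteq> \<sigma> \<and> \<sigma> \<subseteq> \<tau>})"

definition collapsible :: "nat \<Rightarrow> 'v set set \<Rightarrow> bool" where
  "collapsible d X \<longleftrightarrow>
     finite_simplicial_complex X \<and> (elementary_collapse d)\<^sup>*\<^sup>* X {}"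

end

theory Submission
  imports Defs "HOL-Computational_Algebra.Polynomial" "HOL-Library.Multiset"
begin

text \<open>
  The complex is generated by the families \<open>edges_meeting H C\<close> of all edges meeting a fixed set
  \<open>C\<close> with \<open>card C \<le> p\<close>.  The proof bounds the collapsibility of a complex by the length of its
  exclusion sequences, and bounds these lengths for this particular family of generators.

  \<^bold>\<open>Collapsing.\<close>  Let a complex be generated by a finite family \<open>G\<close> of faces, and remove the
  generators one after the other.  When \<open>R\<close> is removed, the faces of \<open>R\<close> that lie in no other
  generator have to be collapsed.  They are organised in a search tree whose nodes are intervals
  \<open>{\<sigma>. S \<subseteq> \<sigma> \<and> \<sigma> \<subseteq> R'}\<close>.  If some other generator \<open>F\<close> contains \<open>S\<close> but misses a vertex \<open>x\<close> of \<open>R'\<close>,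
  then the faces containing \<open>x\<close> form an interval with the larger lower end \<open>insert x S\<close>, and those
  avoiding \<open>x\<close> an interval with the smaller upper end \<open>R' - {x}\<close>; they are collapsed in this
  order.  If some other generator contains all of \<open>R'\<close>, nothing has to be collapsed.
  If no other generator contains \<open>S\<close>, then \<open>R'\<close> is the only maximal face above \<open>S\<close>, and
  the whole interval goes in one elementary collapse.  The lower end \<open>S\<close> is then the set of
  vertices \<open>x\<close> that were put in on the way, each recorded together with the generator \<open>F\<close> that
  misses it while containing all vertices put in before.  Such records are the exclusion
  sequences, and \<open>collapsible_generated_complex\<close> says that a bound on their length bounds the
  dimension of the collapses.

  \<^bold>\<open>Counting.\<close>  For the generators \<open>edges_meeting H C\<close>, an exclusion sequence of length \<open>n\<close>
  consists of edges \<open>A\<^sub>1, \<dots>, A\<^sub>n\<close> and sets \<open>C\<^sub>1, \<dots>, C\<^sub>n\<close> of size at most \<open>p\<close> such that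
  \<open>A\<^sub>i\<close> and \<open>C\<^sub>i\<close> are disjoint while \<open>A\<^sub>i\<close> meets \<open>C\<^sub>j\<close> for \<open>i < j\<close>.  All these edges lie in
  one generator, so some set \<open>D\<close> of size at most \<open>p\<close> meets all of them, and the pair of the empty
  set and \<open>D\<close> prolongs the sequence by one.  Hence
  \<open>skew_set_pair_inequality\<close>, the skew form of Bollobas's theorem, gives \<open>n + 1 \<le> (r + p) choose r\<close>.

  \<^bold>\<open>The skew inequality.\<close>  Regard vertices as distinct numbers and form the matrix with entries
  \<open>\<Prod>b\<in>B\<^sub>j. \<Prod>a\<in>A\<^sub>i. (b - a)\<close>, where smaller sets \<open>B\<^sub>j\<close> are padded to \<open>p\<close> factors by a number
  that represents no vertex.  It is triangular with nonzero diagonal, because an entry vanishes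
  exactly if the two sets meet.  On the other hand its entries are the values of degree-\<open>p\<close> forms
  at the \<open>r + 1\<close> coefficients of the polynomial \<open>\<Prod>a\<in>A\<^sub>i. (X - a)\<close>, so its rank is at most the number
  \<open>(r + p) choose p\<close> of monomials of degree \<open>p\<close> in \<open>r + 1\<close> variables.
\<close>

section \<open>Collapsing a complex along exclusion sequences\<close>

definition generated_complex :: "'v set set \<Rightarrow> 'v set set" where
  "generated_complex G = {\<sigma>. \<exists>F\<in>G. \<sigma> \<subseteq> F}"

text \<open>
  The most recent entry is the head of the list: its face contains all vertices of the tail, so
  that extending a sequence is a single \<open>Cons\<close>.
\<close>
definition exclusion_sequence :: "'v set set \<Rightarrow> ('v \<times> 'v set) list \<Rightarrow> bool" where
  "exclusion_sequence G ps \<longleftrightarrow>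
     (\<forall>(x, F)\<in>set ps. F \<in> G \<and> x \<notin> F) \<and> sorted_wrt (\<lambda>(x, F) (y, F'). y \<in> F) ps"

lemma exclusion_sequence_Nil: "exclusion_sequence G []"
  by (simp add: exclusion_sequence_def)

lemma exclusion_sequence_Cons:
  assumes "exclusion_sequence G ps" "F \<in> G" "x \<notin> F" "fst ` set ps \<subseteq> F"
  shows "exclusion_sequence G ((x, F) # ps)"
  using assms by (auto simp: exclusion_sequence_def)

lemma exclusion_sequence_mono:
  "exclusion_sequence G ps \<Longrightarrow> G \<subseteq> G' \<Longrightarrow> exclusion_sequence G' ps"
  by (auto simp: exclusion_sequence_def)

lemma generated_complex_insert:
  "generated_complex (insert F G) = generated_complex G \<union> Pow F"
  by (auto simp: generated_complex_def)

lemma elementary_collapse_interval: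
  assumes "S \<subseteq> R" "S \<in> Y" "R \<in> Y" "card S \<le> d"
    and "\<And>\<sigma>. \<sigma> \<in> Y \<Longrightarrow> S \<subseteq> \<sigma> \<Longrightarrow> \<sigma> \<subseteq> R"
  shows "elementary_collapse d Y (Y - {\<sigma>. S \<subseteq> \<sigma> \<and> \<sigma> \<subseteq> R})"
proof -
  have max: "maximal_face Y R"
    unfolding maximal_face_def using assms by blast
  have uniq: "\<tau> = R" if "maximal_face Y \<tau>" "S \<subseteq> \<tau>" for \<tau>
    using that assms unfolding maximal_face_def by metis
  have "Y - {\<sigma>. S \<subseteq> \<sigma> \<and> \<sigma> \<subseteq> R} = Y - {\<sigma>\<in>Y. S \<subseteq> \<sigma> \<and> \<sigma> \<subseteq> R}"
    by blast
  moreover have "\<forall>\<tau>. maximal_face Y \<tau> \<and> S \<subseteq> \<tau> \<longrightarrow> \<tau> = R"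
    using uniq by simp
  ultimately show ?thesis
    unfolding elementary_collapse_def
    by (intro exI[of _ S] exI[of _ R] conjI assms(1-4) max)
qed

text \<open>
  This is the search tree, by induction on the size \<open>card (R - S)\<close> of the interval.  The faces in
  \<open>generated_complex G\<close> are to survive, and the hypothesis \<open>above\<close> makes the interval
  the only other part of \<open>Y\<close> above \<open>S\<close>.  In the branch for \<open>x\<close> this hypothesis is inherited because
  the lower end grows; in the branch without \<open>x\<close> it holds because the faces containing \<open>x\<close> have been
  collapsed before.  The upper end \<open>R\<close> shrinks during the induction, so the bound on exclusion
  sequences refers to a fixed \<open>R0\<close> above it.
\<close>
lemma collapse_interval:
  fixes G :: "'v set set"
  assumes bound: "\<And>qs. exclusion_sequence G qs \<Longrightarrow> fst ` set qs \<subseteq> R0 \<Longrightarrow> length qs \<le> d"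
    and "finite R" "S \<subseteq> R" "R \<subseteq> R0"
    and seq: "exclusion_sequence G ps" "S = fst ` set ps"
    and base: "generated_complex G \<subseteq> Y"
    and above: "\<And>\<sigma>. \<sigma> \<in> Y \<Longrightarrow> S \<subseteq> \<sigma> \<Longrightarrow> \<sigma> \<subseteq> R \<or> \<sigma> \<in> generated_complex G"
    and full: "\<And>\<sigma>. S \<subseteq> \<sigma> \<Longrightarrow> \<sigma> \<subseteq> R \<Longrightarrow> \<sigma> \<in> Y"
  shows "(elementary_collapse d)\<^sup>*\<^sup>* Y (Y - ({\<sigma>. S \<subseteq> \<sigma> \<and> \<sigma> \<subseteq> R} - generated_complex G))"
  using assms(2-)
proof (induction "card (R - S)" arbitrary: S R ps Y rule: less_induct)
  case less
  let ?B = "generated_complex G"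
  consider (leaf) "\<And>F. F \<in> G \<Longrightarrow> \<not> S \<subseteq> F" | (inside) F where "F \<in> G" "R \<subseteq> F"
    | (split) F x where "F \<in> G" "S \<subseteq> F" "x \<in> R" "x \<notin> F"
    by blast
  then show ?case
  proof cases
    case leaf
    then have notB: "\<sigma> \<notin> ?B" if "S \<subseteq> \<sigma>" for \<sigma>
      using that by (fastforce simp: generated_complex_def)
    have "card S \<le> length ps"
      using card_image_le[of "set ps" fst] card_length[of ps] less.prems by force
    also have "\<dots> \<le> d"
      using bound[of ps] less.prems by auto
    finally have "card S \<le> d" .
    then have "elementary_collapse d Y (Y - {\<sigma>. S \<subseteq> \<sigma> \<and> \<sigma> \<subseteq> R})"
    proof (rule elementary_collapse_interval[rotated 3])
      show "\<sigma> \<subseteq> R" if "\<sigma> \<in> Y" "S \<subseteq> \<sigma>" for \<sigma>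
        using less.prems(7)[OF that] notB[OF that(2)] by simp
      show "S \<subseteq> R" "S \<in> Y" "R \<in> Y"
        using less.prems(2) less.prems(8)[of S] less.prems(8)[of R] by simp_all
    qed
    moreover have "{\<sigma>. S \<subseteq> \<sigma> \<and> \<sigma> \<subseteq> R} - ?B = {\<sigma>. S \<subseteq> \<sigma> \<and> \<sigma> \<subseteq> R}"
      using notB by blast
    ultimately show ?thesis by simp
  next
    case inside
    then have "{\<sigma>. S \<subseteq> \<sigma> \<and> \<sigma> \<subseteq> R} - ?B = {}"
      by (auto simp: generated_complex_def)
    then show ?thesis by (metis Diff_empty rtranclp.rtrancl_refl)
  next
    case split
    let ?S = "insert x S" and ?R = "R - {x}"
    define Z where "Z = Y - ({\<sigma>. ?S \<subseteq> \<sigma> \<and> \<sigma> \<subseteq> R} - ?B)"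
    have "x \<notin> S" using split by blast
    then have "R - ?S \<subset> R - S" "?R - S \<subset> R - S"
      using split by blast+
    then have smaller: "card (R - ?S) < card (R - S)" "card (?R - S) < card (R - S)"
      using less.prems(1) by (meson finite_Diff psubset_card_mono)+
    have "(elementary_collapse d)\<^sup>*\<^sup>* Y Z"
      unfolding Z_def
    proof (rule less.hyps[OF smaller(1)])
      show "exclusion_sequence G ((x, F) # ps)"
        using split less.prems by (intro exclusion_sequence_Cons) auto
      show "insert x S = fst ` set ((x, F) # ps)"
        using less.prems(5) by simp
      show "?S \<subseteq> R" using split less.prems(2) by simp
      show "\<sigma> \<subseteq> R \<or> \<sigma> \<in> ?B" if "\<sigma> \<in> Y" "?S \<subseteq> \<sigma>" for \<sigma>
        using that less.prems(7) by simp
      show "\<sigma> \<in> Y" if "?S \<subseteq> \<sigma>" "\<sigma> \<subseteq> R" for \<sigma>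
        using that less.prems(8) by simp
    qed (fact less.prems)+
    also have "(elementary_collapse d)\<^sup>*\<^sup>* Z (Z - ({\<sigma>. S \<subseteq> \<sigma> \<and> \<sigma> \<subseteq> ?R} - ?B))"
    proof (rule less.hyps[OF smaller(2)])
      show "exclusion_sequence G ps" "S = fst ` set ps"
        using less.prems by auto
      show "\<sigma> \<subseteq> ?R \<or> \<sigma> \<in> ?B" if "\<sigma> \<in> Z" "S \<subseteq> \<sigma>" for \<sigma>
        using less.prems(7)[of \<sigma>] that by (auto simp: Z_def)
      show "\<sigma> \<in> Z" if "S \<subseteq> \<sigma>" "\<sigma> \<subseteq> ?R" for \<sigma>
        using less.prems(8)[of \<sigma>] that by (auto simp: Z_def)
      show "?B \<subseteq> Z" using less.prems(6) unfolding Z_def by blast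
      show "finite ?R" "S \<subseteq> ?R" "?R \<subseteq> R0"
        using less.prems(1-3) \<open>x \<notin> S\<close> by auto
    qed
    also have "Z - ({\<sigma>. S \<subseteq> \<sigma> \<and> \<sigma> \<subseteq> ?R} - ?B) = Y - ({\<sigma>. S \<subseteq> \<sigma> \<and> \<sigma> \<subseteq> R} - ?B)"
      unfolding Z_def by blast
    finally show ?thesis .
  qed
qed

text \<open>
  The generators are removed one at a time: the faces of \<open>F\<close> that are not shared with the rest are
  the interval from \<open>{}\<close> to \<open>F\<close>, minus the complex generated by the rest.
\<close>
theorem collapsible_generated_complex:
  assumes "finite G" "\<And>F. F \<in> G \<Longrightarrow> finite F"
    and "\<And>ps R. exclusion_sequence G ps \<Longrightarrow> R \<in> G \<Longrightarrow> fst ` set ps \<subseteq> R \<Longrightarrow> length ps \<le> d"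
  shows "collapsible d (generated_complex G)"
proof -
  have "generated_complex G = (\<Union>F\<in>G. Pow F)"
    by (auto simp: generated_complex_def)
  then have "finite (generated_complex G)"
    using assms by simp
  then have complex: "finite_simplicial_complex (generated_complex G)"
    using assms(2)
    by (auto simp: finite_simplicial_complex_def generated_complex_def intro: finite_subset)
  have "(elementary_collapse d)\<^sup>*\<^sup>* (generated_complex G) {}"
    using assms
  proof (induction G rule: finite_induct)
    case empty
    then show ?case by (simp add: generated_complex_def)
  next
    case (insert F G)
    let ?B = "generated_complex G"
    have bound: "length qs \<le> d" if "exclusion_sequence G qs" "fst ` set qs \<subseteq> F" for qs
      using that insert.prems(2)[of qs F] exclusion_sequence_mono[of G qs "insert F G"] by blast
    have "(elementary_collapse d)\<^sup>*\<^sup>* (?B \<union> Pow F) ((?B \<union> Pow F) - ({\<sigma>. {} \<subseteq> \<sigma> \<and> \<sigma> \<subseteq> F} - ?B))"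
      by (rule collapse_interval[where ?R0.0 = F and ps = "[]"])
        (use bound insert.prems in \<open>auto simp: exclusion_sequence_Nil\<close>)
    also have "(?B \<union> Pow F) - ({\<sigma>. {} \<subseteq> \<sigma> \<and> \<sigma> \<subseteq> F} - ?B) = ?B" by blast
    also have "(elementary_collapse d)\<^sup>*\<^sup>* ?B {}"
    proof (rule insert.IH)
      show "length ps \<le> d" if "exclusion_sequence G ps" "R \<in> G" "fst ` set ps \<subseteq> R" for ps R
        using that insert.prems(2)[of ps R] exclusion_sequence_mono[of G ps "insert F G"] by blast
    qed (use insert.prems in auto)
    finally show ?case by (simp add: generated_complex_insert)
  qed
  with complex show ?thesis by (simp add: collapsible_def)
qed

section \<open>The skew set-pair inequality\<close>

lemma underdetermined_system_has_nonzero_solution: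
  fixes X :: "'i \<Rightarrow> 'k \<Rightarrow> 'a::field"
  assumes "finite K" "finite I" "card K < card I"
  shows "\<exists>c. (\<exists>i\<in>I. c i \<noteq> 0) \<and> (\<forall>k\<in>K. (\<Sum>i\<in>I. c i * X i k) = 0)"
  using assms
proof (induction K arbitrary: I X rule: finite_induct)
  case empty
  then have "I \<noteq> {}" by auto
  then show ?case by (auto intro!: exI[of _ "\<lambda>_. 1"])
next
  case (insert k K)
  show ?case
  proof (cases "\<forall>i\<in>I. X i k = 0")
    case True
    moreover have "card K < card I"
      using insert.prems insert.hyps by simp
    then obtain c where "\<exists>i\<in>I. c i \<noteq> 0" "\<forall>k\<in>K. (\<Sum>i\<in>I. c i * X i k) = 0"
      using insert.IH[of I X] insert.prems by blast
    ultimately show ?thesis by (intro exI[of _ c]) simp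
  next
    case False
    then obtain i0 where i0: "i0 \<in> I" "X i0 k \<noteq> 0" by blast
    define J where "J = I - {i0}"
    (* Gaussian elimination: equation k determines the unknown i0 as minus the number s below, and
       X' are the coefficients after substituting it into the other equations. *)
    define X' where "X' i l = X i l - X i k / X i0 k * X i0 l" for i l
    have "card K < card J" "finite J"
      using insert i0 by (auto simp: J_def)
    then obtain c where c: "\<exists>i\<in>J. c i \<noteq> 0" "\<forall>l\<in>K. (\<Sum>i\<in>J. c i * X' i l) = 0"
      using insert.IH[of J X'] by blast
    define s where "s = (\<Sum>i\<in>J. c i * X i k) / X i0 k"
    define e where "e = c(i0 := - s)"
    have I: "(\<Sum>i\<in>I. e i * X i l) = (\<Sum>i\<in>J. c i * X i l) - s * X i0 l" for l
    proof -
      have "(\<Sum>i\<in>I. e i * X i l) = e i0 * X i0 l + (\<Sum>i\<in>J. e i * X i l)"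
        using i0 insert.prems by (simp add: J_def sum.remove)
      also have "(\<Sum>i\<in>J. e i * X i l) = (\<Sum>i\<in>J. c i * X i l)"
        by (intro sum.cong) (auto simp: J_def e_def)
      finally show ?thesis by (simp add: e_def)
    qed
    have X': "(\<Sum>i\<in>J. c i * X' i l) = (\<Sum>i\<in>J. c i * X i l) - s * X i0 l" for l
      by (simp add: X'_def s_def right_diff_distrib sum_subtractf sum_distrib_right
          sum_divide_distrib mult.assoc)
    have "(\<Sum>i\<in>I. e i * X i l) = 0" if "l \<in> insert k K" for l
      using that c(2) i0 by (auto simp: I X'[symmetric]) (simp add: X' s_def)
    moreover have "\<exists>i\<in>I. e i \<noteq> 0"
      using c(1) by (auto simp: e_def J_def)
    ultimately show ?thesis by blast
  qed
qed

text \<open>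
  A triangular matrix with nonzero diagonal has full rank \<open>m\<close>, while factoring through an index set
  \<open>K\<close> bounds the rank by \<open>card K\<close>.  In the proof a vanishing combination \<open>c\<close> of the columns is
  contradicted in the row of its last nonzero coefficient.
\<close>
lemma triangular_factorization_bound:
  fixes M :: "nat \<Rightarrow> nat \<Rightarrow> 'a::field"
  assumes "finite K"
    and fact: "\<And>i j. i < m \<Longrightarrow> j < m \<Longrightarrow> M i j = (\<Sum>k\<in>K. X j k * Y i k)"
    and diag: "\<And>i. i < m \<Longrightarrow> M i i \<noteq> 0"
    and lower: "\<And>i j. j < i \<Longrightarrow> i < m \<Longrightarrow> M i j = 0"
  shows "m \<le> card K"
proof (rule ccontr)
  assume "\<not> m \<le> card K"
  then obtain c where c: "\<exists>j\<in>{..<m}. c j \<noteq> 0" "\<forall>k\<in>K. (\<Sum>j<m. c j * X j k) = 0"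
    using underdetermined_system_has_nonzero_solution[of K "{..<m}" X] \<open>finite K\<close> by auto
  define i where "i = Max {j. j < m \<and> c j \<noteq> 0}"
  have "i \<in> {j. j < m \<and> c j \<noteq> 0}"
    unfolding i_def using c(1) by (intro Max_in) auto
  then have i: "i < m" "c i \<noteq> 0" by auto
  have above: "c j = 0" if "i < j" "j < m" for j
  proof (rule ccontr)
    assume "c j \<noteq> 0"
    then have "j \<le> i"
      unfolding i_def using that(2) by (intro Max_ge) auto
    then show False using that(1) by simp
  qed
  have "(\<Sum>j<m. c j * M i j) = (\<Sum>j<m. \<Sum>k\<in>K. Y i k * (c j * X j k))"
    using i by (intro sum.cong) (auto simp: fact sum_distrib_left mult_ac)
  also have "\<dots> = (\<Sum>k\<in>K. Y i k * (\<Sum>j<m. c j * X j k))"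
    by (subst sum.swap) (simp add: sum_distrib_left)
  also have "\<dots> = 0" using c(2) by simp
  finally have "(\<Sum>j<m. c j * M i j) = 0" .
  moreover have "(\<Sum>j<m. c j * M i j) = c i * M i i"
  proof -
    have "c j * M i j = 0" if "j < m" "j \<noteq> i" for j
      using that above[of j] lower[of j i] i by (cases "j < i") auto
    then have "(\<Sum>j<m. c j * M i j) = (\<Sum>j\<in>{i}. c j * M i j)"
      using i by (intro sum.mono_neutral_right) auto
    then show ?thesis by simp
  qed
  ultimately show False using i diag by simp
qed

text \<open>
  For fixed points \<open>bs\<close>, each \<open>poly P b\<close> is a linear form in the coefficients of \<open>P\<close>, so the product
  is a form of degree \<open>length bs\<close> in them.  The multisets index the monomials of that degree; the
  factor \<open>c\<close> depends only on the points.
\<close>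
lemma prod_list_poly_expansion:
  fixes bs :: "'a::comm_semiring_1 list"
  shows "\<exists>c. \<forall>P. degree P \<le> r \<longrightarrow>
    (\<Prod>b\<leftarrow>bs. poly P b) = (\<Sum>M\<in>multisets_of_size {..r} (length bs). c M * (\<Prod>k\<in>#M. coeff P k))"
proof (induction bs)
  case Nil
  show ?case by (auto intro!: exI[of _ "\<lambda>_. 1"])
next
  case (Cons b bs)
  define T where "T n = multisets_of_size {..r} n" for n
  have finT: "finite (T n)" for n by (auto simp: T_def)
  from Cons obtain c where c: "\<And>P. degree P \<le> r \<Longrightarrow>
    (\<Prod>b\<leftarrow>bs. poly P b) = (\<Sum>M\<in>T (length bs). c M * (\<Prod>k\<in>#M. coeff P k))"
    unfolding T_def by blast
  define S where "S = {..r} \<times> T (length bs)"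
  define c' where "c' N = (\<Sum>(k, M) | (k, M) \<in> S \<and> add_mset k M = N. b ^ k * c M)" for N
  have "(\<Prod>b\<leftarrow>b # bs. poly P b) = (\<Sum>N\<in>T (length (b # bs)). c' N * (\<Prod>k\<in>#N. coeff P k))"
    if P: "degree P \<le> r" for P
  proof -
    let ?h = "\<lambda>(k, M). b ^ k * c M * (\<Prod>l\<in>#add_mset k M. coeff P l)"
    have "poly P b = (\<Sum>k\<le>r. coeff P k * b ^ k)"
      unfolding poly_altdef using P
      by (intro sum.mono_neutral_left) (auto simp: coeff_eq_0)
    then have "(\<Prod>b\<leftarrow>b # bs. poly P b) =
        (\<Sum>k\<le>r. coeff P k * b ^ k) * (\<Sum>M\<in>T (length bs). c M * (\<Prod>k\<in>#M. coeff P k))"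
      by (simp add: c P)
    also have "\<dots> = sum ?h S"
      unfolding sum_product S_def sum.cartesian_product
      by (intro sum.cong) (auto simp: mult_ac)
    also have "\<dots> = (\<Sum>N\<in>T (length (b # bs)). sum ?h {q \<in> S. (case q of (k, M) \<Rightarrow> add_mset k M) = N})"
      by (rule sum.group[symmetric])
        (auto simp: S_def finT, auto simp: T_def multisets_of_size_def)
    also have "\<dots> = (\<Sum>N\<in>T (length (b # bs)). c' N * (\<Prod>k\<in>#N. coeff P k))"
      unfolding c'_def sum_distrib_right
      by (intro sum.cong refl) auto
    finally show ?thesis .
  qed
  then show ?case unfolding T_def by blast
qed

text \<open>
  The condition is asymmetric: only later first components have to meet earlier second components.
  This is why the matrix is merely triangular, and why a rank argument replaces the counting
  argument for the symmetric version.
\<close>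
theorem skew_set_pair_inequality:
  fixes ps :: "('a set \<times> 'a set) list"
  assumes pairs: "\<And>A B. (A, B) \<in> set ps \<Longrightarrow>
      finite A \<and> finite B \<and> card A \<le> r \<and> card B \<le> p \<and> A \<inter> B = {}"
    and skew: "sorted_wrt (\<lambda>(A, B) (A', B'). A' \<inter> B \<noteq> {}) ps"
  shows "length ps \<le> (r + p) choose r"
proof -
  define U where "U = (\<Union>(A, B)\<in>set ps. A \<union> B)"
  have "finite U"
    using pairs by (auto simp: U_def)
  then obtain t :: "'a \<Rightarrow> nat" where t: "inj_on t U"
    using finite_imp_inj_to_nat_seg by metis
  define A where "A i = fst (ps ! i)" for i
  define B where "B i = snd (ps ! i)" for i
  have AB: "finite (A i)" "finite (B i)" "card (A i) \<le> r" "card (B i) \<le> p" "A i \<inter> B i = {}"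
    "A i \<subseteq> U" "B i \<subseteq> U" if "i < length ps" for i
  proof -
    have "(A i, B i) \<in> set ps" using that by (simp add: A_def B_def)
    then show "finite (A i)" "finite (B i)" "card (A i) \<le> r" "card (B i) \<le> p" "A i \<inter> B i = {}"
      "A i \<subseteq> U" "B i \<subseteq> U"
      using pairs[of "A i" "B i"] by (auto simp: U_def)
  qed
  have meet: "A i \<inter> B j \<noteq> {}" if "j < i" "i < length ps" for i j
    using sorted_wrt_nth_less[OF skew that] by (auto simp: A_def B_def split: prod.splits)
  define P :: "nat \<Rightarrow> real poly" where "P i = (\<Prod>a\<in>A i. [:- of_nat (t a), 1:])" for i
  have root: "poly (P i) z = 0 \<longleftrightarrow> (\<exists>a\<in>A i. z = of_nat (t a))" if "i < length ps" for i z
    using AB(1)[OF that] by (auto simp: P_def poly_prod)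
  have deg: "degree (P i) \<le> r" if "i < length ps" for i
  proof -
    have "degree (P i) \<le> (\<Sum>a\<in>A i. degree [:- of_nat (t a), 1 :: real:])"
      unfolding P_def by (rule degree_prod_sum_le[OF AB(1)[OF that], unfolded comp_def])
    also have "\<dots> \<le> r" using AB(3)[OF that] by simp
    finally show ?thesis .
  qed
  (* The forms need the common degree p, so the points of B j are padded up to p of them. The value
     -1 is not a root of any P i, since all roots are natural numbers. *)
  have "\<exists>zs::real list. set zs \<subseteq> insert (- 1) (of_nat ` t ` B j) \<and> of_nat ` t ` B j \<subseteq> set zs
      \<and> length zs = p" if j: "j < length ps" for j
  proof -
    obtain bs where bs: "set bs = B j" "distinct bs"
      using finite_distinct_list[OF AB(2)[OF j]] by blast
    have "length bs \<le> p" using AB(4)[OF j] distinct_card[OF bs(2)] bs(1) by simp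
    with bs show ?thesis
      by (intro exI[of _ "map (of_nat \<circ> t) bs @ replicate (p - length bs) (- 1)"]) auto
  qed
  then obtain z :: "nat \<Rightarrow> real list" where
    z: "\<And>j. j < length ps \<Longrightarrow> set (z j) \<subseteq> insert (- 1) (of_nat ` t ` B j)"
      "\<And>j. j < length ps \<Longrightarrow> of_nat ` t ` B j \<subseteq> set (z j)"
      "\<And>j. j < length ps \<Longrightarrow> length (z j) = p"
    by metis
  let ?K = "multisets_of_size {..r} p"
  have "\<exists>c. \<forall>Q. degree Q \<le> r \<longrightarrow>
      (\<Prod>b\<leftarrow>z j. poly Q b) = (\<Sum>M\<in>?K. c M * (\<Prod>k\<in>#M. coeff Q k))" if "j < length ps" for j
    using prod_list_poly_expansion[where r = r and bs = "z j"] z(3)[OF that] by simp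
  then obtain X where X: "\<And>j Q. j < length ps \<Longrightarrow> degree Q \<le> r \<Longrightarrow>
      (\<Prod>b\<leftarrow>z j. poly Q b) = (\<Sum>M\<in>?K. X j M * (\<Prod>k\<in>#M. coeff Q k))"
    by metis
  have "length ps \<le> card ?K"
  proof (rule triangular_factorization_bound)
    show "finite ?K" by auto
  next
    fix i j assume "i < length ps" "j < length ps"
    then show "(\<Prod>b\<leftarrow>z j. poly (P i) b) = (\<Sum>M\<in>?K. X j M * (\<Prod>k\<in>#M. coeff (P i) k))"
      by (intro X deg)
  next
    fix i assume i: "i < length ps"
    have "poly (P i) b \<noteq> 0" if b: "b \<in> set (z i)" for b
    proof
      assume "poly (P i) b = 0"
      then obtain a where a: "a \<in> A i" "b = of_nat (t a)" using root[OF i] by blast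
      then have "b \<noteq> - 1" by (smt (verit) of_nat_0_le_iff)
      then obtain a' where "a' \<in> B i" "b = of_nat (t a')" using b z(1)[OF i] by blast
      then show False
        using a AB(5-7)[OF i] t by (auto dest: inj_onD)
    qed
    then show "(\<Prod>b\<leftarrow>z i. poly (P i) b) \<noteq> 0"
      by (auto simp: prod_list_zero_iff)
  next
    fix i j assume ij: "j < i" "i < length ps"
    then obtain a where "a \<in> A i" "a \<in> B j" using meet by blast
    then have "of_nat (t a) \<in> set (z j)" "poly (P i) (of_nat (t a)) = 0"
      using ij z(2)[of j] root[of i] by auto
    then show "(\<Prod>b\<leftarrow>z j. poly (P i) b) = 0"
      by (force simp: prod_list_zero_iff)
  qed
  also have "card ?K = (r + p) choose p"
    by (simp add: card_multisets_of_size)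
  also have "\<dots> = (r + p) choose r"
    by (subst binomial_symmetric) auto
  finally show ?thesis .
qed

section \<open>Families of bounded covering number\<close>

lemma covering_number_le_iff:
  "covering_number F \<le> enat p \<longleftrightarrow> (\<exists>C. finite C \<and> card C \<le> p \<and> is_cover C F)"
proof
  assume le: "covering_number F \<le> enat p"
  let ?E = "(\<lambda>C. enat (card C)) ` {C. finite C \<and> is_cover C F}"
  have "?E \<noteq> {}"
  proof
    assume "?E = {}"
    then have "covering_number F = \<infinity>"
      unfolding covering_number_def by (simp only: Inf_empty top_enat_def)
    then show False using le by simp
  qed
  then have "Inf ?E \<in> ?E"
    by (meson wellorder_InfI ex_in_conv)
  then show "\<exists>C. finite C \<and> card C \<le> p \<and> is_cover C F"
    using le by (auto simp: covering_number_def)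
next
  assume "\<exists>C. finite C \<and> card C \<le> p \<and> is_cover C F"
  then show "covering_number F \<le> enat p"
    unfolding covering_number_def by (auto intro: INF_lower2)
qed

definition edges_meeting :: "'a set set \<Rightarrow> 'a set \<Rightarrow> 'a set set" where
  "edges_meeting H C = {A\<in>H. A \<inter> C \<noteq> {}}"

lemma Cov_eq_generated_complex:
  "Cov H p = generated_complex (edges_meeting H ` {C. finite C \<and> card C \<le> p})"
  by (auto simp: Cov_def covering_number_le_iff generated_complex_def edges_meeting_def is_cover_def)

text \<open>
  The inequality is strict because of the extra pair of \<open>{}\<close> and \<open>D\<close>: the empty set is disjoint from
  \<open>D\<close>, and \<open>D\<close> meets every edge of the sequence.  Since the sequence starts with its latest entry,
  this pair goes to the front.
\<close>
lemma length_exclusion_sequence_of_edges: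
  assumes H: "\<And>A. A \<in> H \<Longrightarrow> finite A \<and> card A \<le> r"
    and seq: "exclusion_sequence (edges_meeting H ` {C. finite C \<and> card C \<le> p}) ps"
    and D: "finite D" "card D \<le> p" "fst ` set ps \<subseteq> edges_meeting H D"
  shows "length ps < (r + p) choose r"
proof -
  let ?\<C> = "{C. finite C \<and> card C \<le> p}"
  have "\<forall>F. \<exists>C. F \<in> edges_meeting H ` ?\<C> \<longrightarrow> C \<in> ?\<C> \<and> F = edges_meeting H C"
    by blast
  then obtain cov where cov: "\<And>F. F \<in> edges_meeting H ` ?\<C> \<Longrightarrow> cov F \<in> ?\<C> \<and> F = edges_meeting H (cov F)"
    by metis
  have mem: "A \<in> H" "A \<inter> D \<noteq> {}" "cov F \<in> ?\<C>" "F = edges_meeting H (cov F)" "A \<inter> cov F = {}"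
    if "(A, F) \<in> set ps" for A F
  proof -
    have "A \<in> edges_meeting H D" using that D by force
    then show "A \<in> H" "A \<inter> D \<noteq> {}" by (auto simp: edges_meeting_def)
    have F: "F \<in> edges_meeting H ` ?\<C>" "A \<notin> F"
      using that seq by (auto simp: exclusion_sequence_def)
    show c: "cov F \<in> ?\<C>" "F = edges_meeting H (cov F)" using cov[OF F(1)] by auto
    have "A \<notin> edges_meeting H (cov F)" using F(2) c(2) by simp
    then show "A \<inter> cov F = {}" using \<open>A \<in> H\<close> by (simp add: edges_meeting_def)
  qed
  let ?qs = "({}, D) # map (map_prod id cov) ps"
  have "sorted_wrt (\<lambda>u v. fst v \<inter> cov (snd u) \<noteq> {}) ps"
  proof (rule sorted_wrt_mono_rel)
    show "sorted_wrt (\<lambda>u v. fst v \<in> snd u) ps"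
      using seq by (simp add: exclusion_sequence_def case_prod_beta')
    show "fst v \<inter> cov (snd u) \<noteq> {}" if "u \<in> set ps" "fst v \<in> snd u" for u v
      using that mem(4)[of "fst u" "snd u"] unfolding edges_meeting_def
      by (metis (mono_tags, lifting) mem_Collect_eq prod.collapse)
  qed
  then have "sorted_wrt (\<lambda>(A, B) (A', B'). A' \<inter> B \<noteq> {}) ?qs"
    using mem(2) by (auto simp: sorted_wrt_map case_prod_beta')
  moreover have "finite A \<and> finite B \<and> card A \<le> r \<and> card B \<le> p \<and> A \<inter> B = {}"
    if "(A, B) \<in> set ?qs" for A B
  proof -
    consider "A = {}" "B = D" | F where "(A, F) \<in> set ps" "B = cov F"
      using \<open>(A, B) \<in> set ?qs\<close> by auto
    then show ?thesis
    proof cases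
      case 2
      then show ?thesis using mem(1,3,5)[of A F] H[of A] by simp
    qed (use D in simp)
  qed
  ultimately have "length ?qs \<le> (r + p) choose r"
    by (intro skew_set_pair_inequality) auto
  then show ?thesis by simp
qed

theorem theorem1p2:
  fixes H :: "'a set set" and p r :: nat
  assumes "finite_hypergraph H"
    and "hypergraph_rank H = r"
  shows "collapsible (((r + p) choose r) - 1) (Cov H p)"
proof -
  let ?G = "edges_meeting H ` {C. finite C \<and> card C \<le> p}"
  have "finite H" and fin: "\<And>A. A \<in> H \<Longrightarrow> finite A"
    using assms(1) by (auto simp: finite_hypergraph_def)
  have rank: "card A \<le> r" if "A \<in> H" for A
    using that \<open>finite H\<close> assms(2) by (auto simp: hypergraph_rank_def intro!: Max_ge)
  have sub: "?G \<subseteq> Pow H" by (auto simp: edges_meeting_def)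
  show ?thesis
    unfolding Cov_eq_generated_complex
  proof (rule collapsible_generated_complex)
    show "finite ?G" using sub \<open>finite H\<close> by (auto dest: finite_subset)
    show "finite F" if "F \<in> ?G" for F
      using that sub \<open>finite H\<close> by (auto dest: finite_subset)
    show "length ps \<le> ((r + p) choose r) - 1"
      if seq: "exclusion_sequence ?G ps" and R: "R \<in> ?G" "fst ` set ps \<subseteq> R" for ps R
    proof -
      obtain D where D: "finite D" "card D \<le> p" "R = edges_meeting H D"
        using R(1) by auto
      have "length ps < (r + p) choose r"
        by (rule length_exclusion_sequence_of_edges[OF _ seq D(1,2)])
          (use fin rank R(2) D(3) in simp_all)
      then show ?thesis by simp
    qed
  qed
qed

end
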